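(* (Parameterized characterization of bisimulation.) Let $(M,\Sigma,\theta)$ be a CMK, $m,m'\in M$, and $\varepsilon\geq0$ rational. The following are equivalent: 1. $m\sim m'$; 2. for every $\phi\in\mathcal L$, $m\models_\varepsilon\phi$ iff $m'\models_\varepsilon\phi$; 3. for every $\phi\in\mathcal L^+$, $m\models_\varepsilon\phi$ iff $m'\models_\varepsilon\phi$.
   Context: A continuous Markov kernel (CMK) is $(M,\Sigma,\theta)$ where $(M,\Sigma)$ is an analytic space with Borel $\sigma$-algebra $\Sigma$ and $\theta$ is a measurable map from $M$ to the space of (finite, nonnegative) measures on $(M,\Sigma)$ (with the $\sigma$-algebra generated by $\{\mu:\mu(S)\geq r\}$, $S\in\Sigma$, $r>0$). Bisimulation: for $\mathfrak R\subseteq M\times M$ and $N\subseteq M$, $N^{\mathfrak R}=\{x\in M:\exists n\in N,(n,x)\in\mathfrak R\}$; $N$ is $\mathfrak R$-closed if $N^{\mathfrak R}\subseteq N$. $\mathfrak R$ is a stochastic bisimulation if whenever $(x,y)\in\mathfrak R$, $\theta(x)(C)=\theta(y)(C)$ for every $\mathfrak R$-closed $C\in\Sigma$. $m\sim m'$ iff $m,m'$ are related by some stochastic bisimulation. Formulae $\mathcal L$: $\phi::=\top\mid\neg\phi\mid\phi\land\phi\mid L_r\phi$, $r$ a nonnegative rational; $\mathcal L^+$ is generated by $\psi::=\top\mid\psi\land\psi\mid\psi\lor\psi\mid L_r\psi$. $\varepsilon$-satisfaction: $m\models_\varepsilon\top$; $m\models_\varepsilon\neg\phi$ iff not $m\models_\varepsilon\phi$;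 $m\models_\varepsilon\phi\land\psi$ iff both; $m\models_\varepsilon L_r\phi$ iff $\theta(m)(\llbracket\phi\rrbracket_\varepsilon)+\varepsilon\geq r$, with $\llbracket\phi\rrbracket_\varepsilon=\{x\in M:x\models_\varepsilon\phi\}$. *)

theory Defs
  imports "HOL-Analysis.Analysis"
begin

section \<open>Analytic spaces\<close>

definition polish_topology :: "'a topology \<Rightarrow> bool" where
  "polish_topology X \<longleftrightarrow> completely_metrizable_space X \<and> separable_space X"

text \<open>
  A space is analytic if it is (homeomorphic to) the image of a Polish space under a
  continuous map into a Polish space.  One cannot quantify over the carrier types of the
  two Polish spaces inside a definition, so both carriers are taken to be sets of
  real numbers, with arbitrary Polish topologies unrelated to the usual one.  Since Polish spaces
  have at most continuum many points, this is no restriction; see the lemma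
  \<open>analytic_space_continuous_image\<close> below.
\<close>
definition analytic_space :: "'a topology \<Rightarrow> bool" where
  "analytic_space X \<longleftrightarrow>
     (\<exists>(Y :: real topology) (Z :: real topology) f.
        polish_topology Y \<and> polish_topology Z \<and> continuous_map Y Z f \<and>
        X homeomorphic_space subtopology Z (f ` topspace Y))"

lemma polish_topology_inj_real:
  fixes X :: "'a topology"
  assumes "polish_topology X"
  obtains g :: "'a \<Rightarrow> real" where "inj_on g (topspace X)"
proof -
  obtain M d where M: "Metric_space M d" "X = Metric_space.mtopology M d"
    using assms by (auto simp: polish_topology_def completely_metrizable_space_def)
  interpret Metric_space M d by fact
  obtain D where D: "countable D" "D \<subseteq> M" "mtopology closure_of D = M"
    using assms M(2) by (auto simp: polish_topology_def separable_space_def)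
  define h where "h x = {(c, n :: nat). c \<in> D \<and> d x c < 1 / Suc n}" for x
  have inj: "inj_on h M"
  proof (rule inj_onI, rule ccontr)
    fix x y assume xy: "x \<in> M" "y \<in> M" "h x = h y" "x \<noteq> y"
    then have "d x y > 0" by simp
    then obtain n :: nat where n: "1 / Suc n < d x y / 2"
      using reals_Archimedean[of "d x y / 2"] by (auto simp: inverse_eq_divide)
    have "x \<in> mtopology closure_of D" using D(3) xy(1) by simp
    then obtain c where c: "c \<in> D" "c \<in> mball x (1 / Suc n)"
      unfolding metric_closure_of by (auto dest: spec[of _ "1 / Suc n"])
    then have "d x c < 1 / Suc n" by simp
    moreover from this have "(c, n) \<in> h y" using c(1) xy(3) unfolding h_def by auto
    then have "d y c < 1 / Suc n" by (simp add: h_def)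
    moreover have "d x y \<le> d x c + d y c"
      using triangle[of x c y] commute[of c y] c(1) D(2) xy by auto
    ultimately show False using n by linarith
  qed
  have cnt: "countable (D \<times> (UNIV :: nat set))" using D(1) by simp
  define e where "e S = to_nat_on (D \<times> (UNIV :: nat set)) ` S" for S
  have inj_e: "inj_on e (Pow (D \<times> UNIV))"
    unfolding e_def using inj_on_image_Pow inj_on_to_nat_on[OF cnt] by blast
  have sub: "h ` M \<subseteq> Pow (D \<times> UNIV)" by (auto simp: h_def)
  obtain k :: "nat set \<Rightarrow> real" where k: "inj k"
    using nat_sets_eqpoll_reals by (auto simp: eqpoll_def bij_betw_def)
  have "inj_on (k \<circ> (e \<circ> h)) M"
    by (intro comp_inj_on inj inj_on_subset[OF inj_e sub] inj_on_subset[OF k]) auto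
  then show ?thesis using that M(2) by simp
qed

lemma inj_on_homeomorphic_copy:
  fixes X :: "'a topology" and g :: "'a \<Rightarrow> 'b"
  assumes "inj_on g (topspace X)"
  obtains X' :: "'b topology" where "homeomorphic_map X X' g"
proof -
  define T where "T = (\<lambda>U. U \<subseteq> g ` topspace X \<and> openin X {x \<in> topspace X. g x \<in> U})"
  have T: "istopology T"
    unfolding istopology_def
  proof (intro conjI allI impI)
    fix S U assume "T S" "T U"
    moreover have "{x \<in> topspace X. g x \<in> S \<inter> U} =
        {x \<in> topspace X. g x \<in> S} \<inter> {x \<in> topspace X. g x \<in> U}" by auto
    ultimately show "T (S \<inter> U)" unfolding T_def by (auto simp del: Int_iff)
  next
    fix K assume K: "\<forall>S\<in>K. T S"
    have "{x \<in> topspace X. g x \<in> \<Union>K} = (\<Union>S\<in>K. {x \<in> topspace X. g x \<in> S})" by auto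
    then show "T (\<Union>K)" using K unfolding T_def by (auto simp del: Union_iff)
  qed
  have op: "openin (topology T) = T" using T by (rule topology_inverse')
  have "T (g ` topspace X)"
  proof -
    have "{x \<in> topspace X. g x \<in> g ` topspace X} = topspace X" by auto
    then show ?thesis unfolding T_def by simp
  qed
  moreover have "topspace (topology T) = \<Union>{U. T U}"
    by (simp add: topspace_def[of "topology T"] op)
  ultimately have top: "topspace (topology T) = g ` topspace X"
    by (auto simp: T_def)
  have "homeomorphic_map X (topology T) g"
    unfolding homeomorphic_map_def quotient_map_def
    unfolding top op using assms by (auto simp: T_def)
  then show ?thesis by (rule that)
qed

lemma analytic_space_continuous_image:
  fixes Y :: "'b topology" and Z :: "'c topology"
  assumes Y: "polish_topology Y" and Z: "polish_topology Z" and f: "continuous_map Y Z f"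
  shows "analytic_space (subtopology Z (f ` topspace Y))"
proof -
  obtain g :: "'b \<Rightarrow> real" where "inj_on g (topspace Y)"
    using polish_topology_inj_real[OF Y] .
  then obtain Y' where Y': "homeomorphic_map Y Y' g"
    using inj_on_homeomorphic_copy by blast
  obtain k :: "'c \<Rightarrow> real" where "inj_on k (topspace Z)"
    using polish_topology_inj_real[OF Z] .
  then obtain Z' where Z': "homeomorphic_map Z Z' k"
    using inj_on_homeomorphic_copy by blast
  obtain g' where g': "homeomorphic_maps Y Y' g g'"
    using Y' by (auto simp: homeomorphic_map_maps)
  have img: "g' ` topspace Y' = topspace Y"
    using g' homeomorphic_imp_surjective_map homeomorphic_maps_map by blast
  have hs: "Y homeomorphic_space Y'" "Z homeomorphic_space Z'"
    using Y' Z' homeomorphic_map_imp_homeomorphic_space by blast+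
  have "polish_topology Y'" "polish_topology Z'"
    using Y Z hs homeomorphic_completely_metrizable_space
      separable_space_continuous_map_image[OF _ homeomorphic_imp_continuous_map[OF Y']]
      separable_space_continuous_map_image[OF _ homeomorphic_imp_continuous_map[OF Z']]
      homeomorphic_imp_surjective_map[OF Y'] homeomorphic_imp_surjective_map[OF Z']
    unfolding polish_topology_def by auto
  moreover have "continuous_map Y' Z' (k \<circ> f \<circ> g')"
    using g' Z' f homeomorphic_imp_continuous_map
    by (metis continuous_map_compose homeomorphic_maps_def)
  moreover have "subtopology Z (f ` topspace Y) homeomorphic_space
      subtopology Z' ((k \<circ> f \<circ> g') ` topspace Y')"
  proof -
    have "f ` topspace Y \<subseteq> topspace Z"
      using f by (simp add: continuous_map_image_subset_topspace)
    then have "homeomorphic_map (subtopology Z (f ` topspace Y))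
        (subtopology Z' (k ` f ` topspace Y)) k"
      using homeomorphic_imp_surjective_map[OF Z'] homeomorphic_imp_injective_map[OF Z']
      by (intro homeomorphic_map_subtopologies Z') (auto simp: inj_on_def)
    moreover have "(k \<circ> f \<circ> g') ` topspace Y' = k ` f ` topspace Y"
      using img by (metis image_comp)
    ultimately show ?thesis
      using homeomorphic_map_imp_homeomorphic_space by fastforce
  qed
  ultimately show ?thesis unfolding analytic_space_def by blast
qed

section \<open>Continuous Markov kernels\<close>

definition finite_measures :: "'a measure \<Rightarrow> 'a measure set" where
  "finite_measures M = {\<mu>. sets \<mu> = sets M \<and> finite_measure \<mu>}"

definition finite_measure_space :: "'a measure \<Rightarrow> 'a measure measure" where
  "finite_measure_space M = sigma (finite_measures M)
     {{\<mu> \<in> finite_measures M. measure \<mu> S \<ge> r} | S r. S \<in> sets M \<and> (r :: real) > 0}"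

text \<open>
  The state space \<open>(M, \<Sigma>)\<close> is represented by a value \<open>M\<close> of type \<open>'a measure\<close>, of which only
  \<open>space M\<close> and \<open>sets M\<close> matter.
\<close>
definition continuous_markov_kernel :: "'a measure \<Rightarrow> ('a \<Rightarrow> 'a measure) \<Rightarrow> bool" where
  "continuous_markov_kernel M \<theta> \<longleftrightarrow>
     (\<exists>X. analytic_space X \<and> space M = topspace X \<and>
          sets M = sigma_sets (topspace X) {U. openin X U}) \<and>
     \<theta> \<in> measurable M (finite_measure_space M)"

section \<open>Stochastic bisimulation\<close>

definition rel_closed :: "('a \<times> 'a) set \<Rightarrow> 'a set \<Rightarrow> bool" where
  "rel_closed R N \<longleftrightarrow> R `` N \<subseteq> N"

definition stochastic_bisimulation ::
  "'a measure \<Rightarrow> ('a \<Rightarrow> 'a measure) \<Rightarrow> ('a \<times> 'a) set \<Rightarrow> bool" where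
  "stochastic_bisimulation M \<theta> R \<longleftrightarrow>
     R \<subseteq> space M \<times> space M \<and>
     (\<forall>(x, y) \<in> R. \<forall>C \<in> sets M. rel_closed R C \<longrightarrow> measure (\<theta> x) C = measure (\<theta> y) C)"

definition bisimilar :: "'a measure \<Rightarrow> ('a \<Rightarrow> 'a measure) \<Rightarrow> 'a \<Rightarrow> 'a \<Rightarrow> bool" where
  "bisimilar M \<theta> m m' \<longleftrightarrow> (\<exists>R. stochastic_bisimulation M \<theta> R \<and> (m, m') \<in> R)"

section \<open>Formulae and parameterized satisfaction\<close>

datatype fm = Top | Neg fm | And fm fm | L rat fm

text \<open>Disjunction is the usual derived operator of the full language.\<close>
abbreviation Or :: "fm \<Rightarrow> fm \<Rightarrow> fm" where
  "Or \<phi> \<psi> \<equiv> Neg (And (Neg \<phi>) (Neg \<psi>))"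

inductive_set formulae :: "fm set" where
  "Top \<in> formulae"
| "\<phi> \<in> formulae \<Longrightarrow> Neg \<phi> \<in> formulae"
| "\<phi> \<in> formulae \<Longrightarrow> \<psi> \<in> formulae \<Longrightarrow> And \<phi> \<psi> \<in> formulae"
| "\<phi> \<in> formulae \<Longrightarrow> r \<ge> 0 \<Longrightarrow> L r \<phi> \<in> formulae"

inductive_set positive_formulae :: "fm set" where
  "Top \<in> positive_formulae"
| "\<phi> \<in> positive_formulae \<Longrightarrow> \<psi> \<in> positive_formulae \<Longrightarrow> And \<phi> \<psi> \<in> positive_formulae"
| "\<phi> \<in> positive_formulae \<Longrightarrow> \<psi> \<in> positive_formulae \<Longrightarrow> Or \<phi> \<psi> \<in> positive_formulae"
| "\<phi> \<in> positive_formulae \<Longrightarrow> r \<ge> 0 \<Longrightarrow> L r \<phi> \<in> positive_formulae"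

fun sat :: "'a measure \<Rightarrow> ('a \<Rightarrow> 'a measure) \<Rightarrow> rat \<Rightarrow> 'a \<Rightarrow> fm \<Rightarrow> bool" where
  "sat M \<theta> \<epsilon> m Top \<longleftrightarrow> True"
| "sat M \<theta> \<epsilon> m (Neg \<phi>) \<longleftrightarrow> \<not> sat M \<theta> \<epsilon> m \<phi>"
| "sat M \<theta> \<epsilon> m (And \<phi> \<psi>) \<longleftrightarrow> sat M \<theta> \<epsilon> m \<phi> \<and> sat M \<theta> \<epsilon> m \<psi>"
| "sat M \<theta> \<epsilon> m (L r \<phi>) \<longleftrightarrow>
     measure (\<theta> m) {x \<in> space M. sat M \<theta> \<epsilon> x \<phi>} + of_rat \<epsilon> \<ge> of_rat r"

end

theory Submission
  imports Defs
begin

text \<open>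
  A positive formula \<open>L (r + \<epsilon>)\<close> read up to \<open>\<epsilon>\<close> is \<open>L r\<close> read exactly, so positive equivalence
  of \<open>x\<close> and \<open>y\<close> means that \<open>\<theta> x\<close> and \<open>\<theta> y\<close> agree on all formula sets, hence (these
  form a \<open>\<pi>\<close>-system) on the \<open>\<sigma>\<close>-algebra they generate.  That this
  suffices is Blackwell's theorem: in an analytic space, a Borel set that is saturated for a
  countable family of Borel sets belongs to the \<open>\<sigma>\<close>-algebra generated by the family.  It pulls
  back along a continuous surjection, so it is enough to treat a Polish space.  There, every Borel
  set \<open>B\<close> admits countably many countable covers such that a shrinking sequence of sets which
  gets inside a member of each cover must end up inside \<open>B\<close> or inside its complement, on the same
  side as its limit.  If a saturated \<open>C\<close> could not be separated from its complement, one could shrink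
  both through all relevant covers while keeping them inseparable; the two limit points would
  lie on different sides of \<open>C\<close> but on the same side of each set of the family.
\<close>

section \<open>Blackwell's theorem\<close>

context Metric_space
begin

text \<open>The limit \<open>y\<close> need not lie in any \<open>A n\<close>, so membership of late
  terms in a set says nothing by itself about membership of \<open>y\<close>. Closing this gap is
  the task of the covers.\<close>

definition shrinks_to :: "(nat \<Rightarrow> 'a set) \<Rightarrow> 'a \<Rightarrow> bool" where
  "shrinks_to A y \<longleftrightarrow> decseq A \<and> (\<forall>n. A n \<noteq> {} \<and> A n \<subseteq> M) \<and> y \<in> M \<and>
     (\<forall>e>0. \<exists>n. A n \<subseteq> mball y e)"

definition meets :: "(nat \<Rightarrow> 'a set) \<Rightarrow> (nat \<Rightarrow> 'a set) \<Rightarrow> bool" where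
  "meets A T \<longleftrightarrow> (\<exists>n i. A n \<subseteq> T i)"

text \<open>The disjunction asserts two things at once: late terms fall on one side of
  \<open>B\<close>, and the limit falls on the same side. A countable family of covers is allowed,
  rather than one cover, so that the families of countably many sets can be merged.\<close>

definition decided_by :: "(nat \<Rightarrow> 'a set) set \<Rightarrow> 'a set \<Rightarrow> bool" where
  "decided_by \<T> B \<longleftrightarrow> countable \<T> \<and> (\<forall>T\<in>\<T>. M \<subseteq> (\<Union>i. T i)) \<and>
     (\<forall>A y. shrinks_to A y \<longrightarrow> (\<forall>T\<in>\<T>. meets A T) \<longrightarrow>
        y \<in> B \<and> (\<exists>n. A n \<subseteq> B) \<or> y \<notin> B \<and> (\<exists>n. A n \<inter> B = {}))"

text \<open>One cover suffices: the complement of \<open>U\<close>, and for each \<open>k\<close>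
  the points whose distance to the complement has the uniform margin \<open>1 / Suc k\<close>. Sets
  in the complement cannot shrink to a point of the open set \<open>U\<close>, and a uniform margin
  keeps the limit inside \<open>U\<close>.\<close>

lemma decided_by_open:
  assumes U: "openin mtopology U"
  shows "\<exists>\<T>. decided_by \<T> U"
proof -
  define T where "T i = (case i of 0 \<Rightarrow> M - U | Suc k \<Rightarrow> {x \<in> M. mball x (1 / Suc k) \<subseteq> U})" for i
  have "M \<subseteq> (\<Union>i. T i)"
  proof
    fix x assume x: "x \<in> M"
    show "x \<in> (\<Union>i. T i)"
    proof (cases "x \<in> U")
      case True
      then obtain r where r: "r > 0" "mball x r \<subseteq> U" using U by (auto simp: openin_mtopology)
      obtain k :: nat where k: "1 / Suc k < r"
        using reals_Archimedean[OF r(1)] by (auto simp: inverse_eq_divide)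
      have "mball x (1 / Suc k) \<subseteq> mball x r" using k by (intro mball_subset_concentric) simp
      then have "x \<in> T (Suc k)" using r(2) x by (auto simp: T_def)
      then show ?thesis by blast
    next
      case False
      then have "x \<in> T 0" using x by (simp add: T_def)
      then show ?thesis by blast
    qed
  qed
  moreover have "y \<in> U \<and> (\<exists>n. A n \<subseteq> U) \<or> y \<notin> U \<and> (\<exists>n. A n \<inter> U = {})"
    if A: "shrinks_to A y" and AT: "meets A T" for A y
  proof -
    obtain n i where ni: "A n \<subseteq> T i" using AT by (auto simp: meets_def)
    \<comment> \<open>The later of two terms is nonempty and lies in both, so the fixed set
      \<open>A n\<close> has points arbitrarily near \<open>y\<close>.\<close>
    have close: "\<exists>x. x \<in> A n \<and> x \<in> mball y e" if e: "e > 0" for e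
    proof -
      obtain m where "A m \<subseteq> mball y e" using A e unfolding shrinks_to_def by blast
      moreover have "A (max n m) \<subseteq> A n" "A (max n m) \<subseteq> A m" "A (max n m) \<noteq> {}"
        using A by (auto simp: shrinks_to_def decseq_def)
      ultimately show ?thesis by blast
    qed
    show ?thesis
    proof (cases i)
      case 0
      then have "A n \<inter> U = {}" using ni by (auto simp: T_def)
      moreover have "y \<notin> U"
      proof
        assume "y \<in> U"
        then obtain e where "e > 0" "mball y e \<subseteq> U" using U by (auto simp: openin_mtopology)
        then show False using close \<open>A n \<inter> U = {}\<close> by blast
      qed
      ultimately show ?thesis by blast
    next
      case (Suc k)
      then have sub: "A n \<subseteq> {x \<in> M. mball x (1 / Suc k) \<subseteq> U}" using ni by (simp add: T_def)
      obtain x where x: "x \<in> A n" "x \<in> mball y (1 / Suc k)" using close[of "1 / Suc k"] by auto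
      then have "y \<in> mball x (1 / Suc k)" by (simp add: commute)
      then have "y \<in> U" using sub x(1) by blast
      moreover have "A n \<subseteq> U"
      proof
        fix z assume "z \<in> A n"
        then have "z \<in> M" "mball z (1 / Suc k) \<subseteq> U" using sub by auto
        then show "z \<in> U" using centre_in_mball_iff[of z "1 / Suc k"] by (simp add: subset_iff)
      qed
      ultimately show ?thesis by blast
    qed
  qed
  ultimately have "decided_by {T} U" by (simp add: decided_by_def)
  then show ?thesis ..
qed

text \<open>Induction on the generation of Borel sets. A complement keeps its covers, since the
  condition is symmetric in the two sides. A union merges the covers of its members and adds one
  more, made of the members and the complement of the union.\<close>

lemma decided_by_borel:
  assumes "B \<in> sigma_sets M (Collect (openin mtopology))"
  shows "\<exists>\<T>. decided_by \<T> B"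
  using assms
proof induction
  case (Basic U)
  then show ?case using decided_by_open by simp
next
  case Empty
  show ?case by (rule decided_by_open) simp
next
  case (Compl B)
  then obtain \<T> where T: "decided_by \<T> B" by blast
  have "decided_by \<T> (M - B)"
    unfolding decided_by_def
  proof (intro conjI allI impI)
    fix A y assume A: "shrinks_to A y" and "\<forall>T\<in>\<T>. meets A T"
    then have "y \<in> B \<and> (\<exists>n. A n \<subseteq> B) \<or> y \<notin> B \<and> (\<exists>n. A n \<inter> B = {})"
      using T by (simp add: decided_by_def)
    then show "y \<in> M - B \<and> (\<exists>n. A n \<subseteq> M - B) \<or> y \<notin> M - B \<and> (\<exists>n. A n \<inter> (M - B) = {})"
    proof (elim disjE conjE exE)
      fix n assume "y \<in> B" "A n \<subseteq> B"
      then have "y \<notin> M - B" "A n \<inter> (M - B) = {}" by auto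
      then show ?thesis by blast
    next
      fix n assume "y \<notin> B" "A n \<inter> B = {}"
      moreover have "y \<in> M" "A n \<subseteq> M" using A by (auto simp: shrinks_to_def)
      ultimately have "y \<in> M - B" "A n \<subseteq> M - B" by auto
      then show ?thesis by blast
    qed
  qed (use T in \<open>auto simp: decided_by_def\<close>)
  then show ?case ..
next
  case (Union B)
  then obtain \<T> where T: "\<And>i. decided_by (\<T> i) (B i)" by metis
  define T where "T i = (case i of 0 \<Rightarrow> M - (\<Union>i. B i) | Suc k \<Rightarrow> B k)" for i
  have "M \<subseteq> (\<Union>i. T i)"
  proof
    fix x assume x: "x \<in> M"
    show "x \<in> (\<Union>i. T i)"
    proof (cases "x \<in> (\<Union>i. B i)")
      case True
      then obtain k where "x \<in> T (Suc k)" by (auto simp: T_def)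
      then show ?thesis by blast
    next
      case False
      then have "x \<in> T 0" using x by (simp add: T_def)
      then show ?thesis by blast
    qed
  qed
  moreover have "y \<in> (\<Union>i. B i) \<and> (\<exists>n. A n \<subseteq> (\<Union>i. B i)) \<or>
      y \<notin> (\<Union>i. B i) \<and> (\<exists>n. A n \<inter> (\<Union>i. B i) = {})"
    if A: "shrinks_to A y" and AT: "meets A T" and AB: "\<And>i. \<forall>T\<in>\<T> i. meets A T" for A y
  proof -
    have dec: "y \<in> B i \<and> (\<exists>n. A n \<subseteq> B i) \<or> y \<notin> B i \<and> (\<exists>n. A n \<inter> B i = {})" for i
      using T[of i] A AB[of i] unfolding decided_by_def by blast
    obtain n i where ni: "A n \<subseteq> T i" using AT by (auto simp: meets_def)
    \<comment> \<open>Any two terms overlap, so a verdict on \<open>B k\<close> reached at another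
      index cannot contradict the one at \<open>n\<close>.\<close>
    have overlap: "A n \<inter> A m \<noteq> {}" for m
    proof -
      have "A (max n m) \<subseteq> A n" "A (max n m) \<subseteq> A m" "A (max n m) \<noteq> {}"
        using A by (auto simp: shrinks_to_def decseq_def)
      then show ?thesis by blast
    qed
    show ?thesis
    proof (cases i)
      case 0
      then have disj: "A n \<inter> (\<Union>i. B i) = {}" using ni by (auto simp: T_def)
      have "y \<notin> B k" for k
      proof
        assume "y \<in> B k"
        then obtain m where "A m \<subseteq> B k" using dec by blast
        then show False using overlap[of m] disj by blast
      qed
      then show ?thesis using disj by blast
    next
      case (Suc k)
      then have sub: "A n \<subseteq> B k" using ni by (simp add: T_def)
      have "y \<in> B k"
      proof (rule ccontr)
        assume "y \<notin> B k"
        then obtain m where "A m \<inter> B k = {}" using dec by blast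
        then show False using overlap[of m] sub by blast
      qed
      then show ?thesis using sub by blast
    qed
  qed
  ultimately have "decided_by (insert T (\<Union>i. \<T> i)) (\<Union>i. B i)"
    using T by (simp add: decided_by_def)
  then show ?case ..
qed

text \<open>Take, for each \<open>n\<close>, the balls of radius \<open>1 / Suc n\<close> around a
  countable dense set. A set inside such a ball has small diameter, so points picked from the terms
  form a Cauchy sequence, and completeness provides the limit.\<close>

lemma covers_forcing_convergence:
  assumes complete: mcomplete and separable: "separable_space mtopology"
  obtains \<T> where "countable \<T>" "\<forall>T\<in>\<T>. M \<subseteq> (\<Union>i :: nat. T i)"
    "\<forall>A. decseq A \<longrightarrow> (\<forall>n. A n \<noteq> {} \<and> A n \<subseteq> M) \<longrightarrow> (\<forall>T\<in>\<T>. meets A T) \<longrightarrow> (\<exists>y. shrinks_to A y)"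
proof -
  obtain D where D: "countable D" "D \<subseteq> M" "mtopology closure_of D = M"
    using separable by (auto simp: separable_space_def)
  \<comment> \<open>If \<open>D\<close> is empty, \<open>from_nat_into D\<close> has an arbitrary
    value; this is harmless, as \<open>M\<close> is then empty too.\<close>
  define T where "T n i = mball (from_nat_into D i) (1 / Suc n)" for n i :: nat
  show ?thesis
  proof (rule that[of "range T"])
    show "\<forall>S\<in>range T. M \<subseteq> (\<Union>i. S i)"
    proof (intro ballI subsetI)
      fix S x assume "S \<in> range T" "x \<in> M"
      obtain n where n: "S = T n" using \<open>S \<in> range T\<close> by blast
      have "x \<in> mtopology closure_of D" using D(3) \<open>x \<in> M\<close> by simp
      then obtain c where c: "c \<in> D" "c \<in> mball x (1 / Suc n)"
        unfolding metric_closure_of by (auto dest: spec[of _ "1 / Suc n"])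
      then obtain i where "c = from_nat_into D i" using D(1) by (metis from_nat_into_surj)
      then have "x \<in> T n i" using c(2) by (simp add: T_def commute)
      then show "x \<in> (\<Union>i. S i)" using n by blast
    qed
  next
    have "\<exists>y. shrinks_to A y"
      if dec: "decseq A" and A: "\<And>n. A n \<noteq> {} \<and> A n \<subseteq> M" and T: "\<And>S. S \<in> range T \<Longrightarrow> meets A S" for A
    proof -
      have small: "\<exists>N. \<forall>a\<in>A N. \<forall>b\<in>A N. d a b < e" if e: "e > 0" for e
      proof -
        obtain k :: nat where k: "1 / Suc k < e / 2"
          using reals_Archimedean[of "e / 2"] e by (auto simp: inverse_eq_divide)
        obtain N i where "A N \<subseteq> T k i" using T[of "T k"] by (auto simp: meets_def)
        then have sub: "A N \<subseteq> mball (from_nat_into D i) (1 / Suc k)" by (simp add: T_def)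
        have "d a b < e" if "a \<in> A N" "b \<in> A N" for a b
        proof -
          have a: "d (from_nat_into D i) a < 1 / Suc k" "a \<in> M" "from_nat_into D i \<in> M"
            and b: "d (from_nat_into D i) b < 1 / Suc k" "b \<in> M"
            using that sub by auto
          then show ?thesis
            using triangle[of a "from_nat_into D i" b] k commute[of a "from_nat_into D i"] by linarith
        qed
        then show ?thesis by blast
      qed
      define x where "x n = (SOME a. a \<in> A n)" for n
      have x: "x n \<in> A n" for n using A[of n] unfolding x_def by (simp add: some_in_eq)
      have xA: "x n \<in> A N" if "N \<le> n" for n N using x[of n] dec that by (auto simp: decseq_def)
      have "MCauchy x"
        unfolding MCauchy_def
      proof (intro conjI allI impI)
        show "range x \<subseteq> M" using x A by blast
        fix e :: real assume "e > 0"
        then show "\<exists>N. \<forall>n n'. N \<le> n \<longrightarrow> N \<le> n' \<longrightarrow> d (x n) (x n') < e" using small xA by metis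
      qed
      then obtain y where y: "limitin mtopology x y sequentially"
        using complete by (auto simp: mcomplete_def)
      then have yM: "y \<in> M" by (simp add: limit_metric_sequentially)
      have "\<exists>n. A n \<subseteq> mball y e" if e: "e > 0" for e
      proof -
        obtain N where N: "\<forall>a\<in>A N. \<forall>b\<in>A N. d a b < e / 2" using small[of "e / 2"] e by auto
        obtain N' where N': "\<forall>n\<ge>N'. x n \<in> M \<and> d (x n) y < e / 2"
          using y e unfolding limit_metric_sequentially by (metis half_gt_zero)
        define z where "z = x (max N N')"
        have z: "z \<in> A N" "z \<in> M" "d z y < e / 2" using N' xA by (auto simp: z_def)
        have "a \<in> mball y e" if a: "a \<in> A N" for a
        proof -
          have "d y a \<le> d y z + d z a" using triangle yM z(2) a A by blast
          moreover have "d z a < e / 2" using N z(1) a by blast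
          ultimately show ?thesis using z(3) commute[of y z] yM a A by (auto simp: subset_iff)
        qed
        then show ?thesis by blast
      qed
      then show ?thesis using dec A yM unfolding shrinks_to_def by blast
    qed
    then show "\<forall>A. decseq A \<longrightarrow> (\<forall>n. A n \<noteq> {} \<and> A n \<subseteq> M) \<longrightarrow> (\<forall>S\<in>range T. meets A S) \<longrightarrow>
      (\<exists>y. shrinks_to A y)" by blast
  qed simp
qed

end

section \<open>Separation by a \<sigma>-algebra, and Blackwell's theorem in complete separable
  metric spaces\<close>

definition separated :: "'a set set \<Rightarrow> 'a set \<Rightarrow> 'a set \<Rightarrow> bool" where
  "separated \<S> A B \<longleftrightarrow> (\<exists>E\<in>\<S>. A \<subseteq> E \<and> B \<inter> E = {})"

text \<open>If \<open>E i j\<close> separates the pieces with indices \<open>i\<close> and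
  \<open>j\<close>, then the union over \<open>i\<close> of the intersections over \<open>j\<close>
  separates the whole sets. It is used contrapositively: an inseparable pair has an inseparable pair
  of pieces.\<close>

lemma (in sigma_algebra) separated_cover:
  fixes S T :: "nat \<Rightarrow> 'a set"
  assumes A: "A \<subseteq> (\<Union>i. S i)" and B: "B \<subseteq> (\<Union>j. T j)"
    and sep: "\<And>i j. separated M (A \<inter> S i) (B \<inter> T j)"
  shows "separated M A B"
proof -
  obtain E where E: "\<And>i j. E i j \<in> M \<and> A \<inter> S i \<subseteq> E i j \<and> B \<inter> T j \<inter> E i j = {}"
    using sep unfolding separated_def by metis
  have "(\<Union>i. \<Inter>j. E i j) \<in> M" using E by (intro countable_nat_UN countable_INT) auto
  moreover have "A \<subseteq> (\<Union>i. \<Inter>j. E i j)"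
  proof
    fix x assume "x \<in> A"
    then obtain i where "x \<in> A \<inter> S i" using A by blast
    then show "x \<in> (\<Union>i. \<Inter>j. E i j)" using E[of i] by blast
  qed
  moreover have "x \<notin> (\<Union>i. \<Inter>j. E i j)" if x: "x \<in> B" for x
  proof -
    obtain j where "x \<in> B \<inter> T j" using B x by blast
    then have "x \<notin> E i j" for i using E[of i j] by blast
    then show ?thesis by blast
  qed
  ultimately show ?thesis unfolding separated_def by blast
qed

text \<open>\<open>C\<close> is generated by \<open>\<G>\<close> as soon as a generated set
  separates it from \<open>M - C\<close>. Otherwise the shrinking construction yields limits
  \<open>c\<close> and \<open>e\<close> that some \<open>G\<close> in \<open>\<G>\<close> tells
  apart; as \<open>G\<close> is decided along both sequences, \<open>G\<close> or
  \<open>M - G\<close> separates late terms, against their inseparability.\<close>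

lemma (in Metric_space) blackwell:
  assumes mcomplete "separable_space mtopology"
    and \<G>: "countable \<G>" "\<G> \<subseteq> sigma_sets M (Collect (openin mtopology))"
    and C: "C \<in> sigma_sets M (Collect (openin mtopology))"
    and saturated: "\<And>x y. \<lbrakk>x \<in> C; y \<in> M - C\<rbrakk> \<Longrightarrow> \<exists>G\<in>\<G>. \<not> (x \<in> G \<longleftrightarrow> y \<in> G)"
  shows "C \<in> sigma_sets M \<G>"
proof (rule ccontr)
  let ?S = "sigma_sets M \<G>"
  have sub: "B \<subseteq> M" if "B \<in> sigma_sets M (Collect (openin mtopology))" for B
    using that by (rule sigma_sets_into_sp[rotated]) (use openin_subset in force)
  interpret S: sigma_algebra M ?S
    using \<G>(2) sub by (intro sigma_algebra_sigma_sets) auto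
  assume "C \<notin> ?S"
  have start: "\<not> separated ?S C (M - C)"
  proof
    assume "separated ?S C (M - C)"
    then obtain E where E: "E \<in> ?S" "C \<subseteq> E" "(M - C) \<inter> E = {}" by (auto simp: separated_def)
    then have "E = C" using S.sets_into_space by blast
    then show False using E(1) \<open>C \<notin> ?S\<close> by simp
  qed
  obtain \<T>0 where T0: "countable \<T>0" "\<forall>T\<in>\<T>0. M \<subseteq> (\<Union>i :: nat. T i)"
    "\<forall>A. decseq A \<longrightarrow> (\<forall>n. A n \<noteq> {} \<and> A n \<subseteq> M) \<longrightarrow> (\<forall>T\<in>\<T>0. meets A T) \<longrightarrow> (\<exists>y. shrinks_to A y)"
    using covers_forcing_convergence[OF assms(1,2)] .
  obtain \<T>1 where T1: "\<And>B. B \<in> insert C \<G> \<Longrightarrow> decided_by (\<T>1 B) B"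
    using decided_by_borel C \<G>(2) by (metis insert_iff subsetD)
  define \<T> where "\<T> = \<T>0 \<union> (\<Union>B\<in>insert C \<G>. \<T>1 B)"
  have "countable \<T>"
    unfolding \<T>_def using T0(1) T1 \<G>(1)
    by (intro countable_Un countable_UN) (auto simp: decided_by_def)
  \<comment> \<open>The trivial constant cover makes the family nonempty, so that
    \<open>from_nat_into\<close> enumerates exactly this family.\<close>
  then have cnt: "countable (insert (\<lambda>i. M) \<T>)" by simp
  define T where "T = from_nat_into (insert (\<lambda>i :: nat. M) \<T>)"
  have range_T: "range T = insert (\<lambda>i. M) \<T>" unfolding T_def using cnt by (intro range_from_nat_into) auto
  have cover: "M \<subseteq> (\<Union>i. T n i)" for n
  proof -
    have "T n \<in> insert (\<lambda>i. M) \<T>" using range_T by blast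
    then consider "T n = (\<lambda>i. M)" | "T n \<in> \<T>0" | B where "B \<in> insert C \<G>" "T n \<in> \<T>1 B"
      unfolding \<T>_def by blast
    then show ?thesis
    proof cases
      case 3
      then show ?thesis using T1[of B] by (simp add: decided_by_def)
    qed (use T0(2) in simp_all)
  qed
  \<comment> \<open>\<open>P\<close> is the invariant of the construction. Step \<open>n\<close>
    cuts both sets with members of the same cover \<open>T n\<close>, with independently chosen
    indices.\<close>
  define P where "P = (\<lambda>(A, B). A \<subseteq> C \<and> B \<subseteq> M - C \<and> \<not> separated ?S A B)"
  define Q where "Q = (\<lambda>n (A, B) (A', B'). \<exists>i j. A' = A \<inter> T n i \<and> B' = B \<inter> T n j)"
  have "\<exists>f. \<forall>n. P (f n) \<and> Q n (f n) (f (Suc n))"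
  proof (rule dependent_nat_choice)
    have "P (C, M - C)" using start by (simp add: P_def)
    then show "\<exists>s. P s" by blast
  next
    fix s n assume Ps: "P s"
    obtain A B where s: "s = (A, B)" by fastforce
    have "\<exists>i j. \<not> separated ?S (A \<inter> T n i) (B \<inter> T n j)"
    proof (rule ccontr)
      assume "\<not> ?thesis"
      then have "separated ?S A B"
        using Ps sub[OF C] cover[of n] unfolding s P_def
        by (intro S.separated_cover[of A "T n" B "T n"]) auto
      then show False using Ps by (simp add: s P_def)
    qed
    then obtain i j where "\<not> separated ?S (A \<inter> T n i) (B \<inter> T n j)" by blast
    then have "P (A \<inter> T n i, B \<inter> T n j) \<and> Q n s (A \<inter> T n i, B \<inter> T n j)"
      using Ps by (auto simp: P_def Q_def s)
    then show "\<exists>s'. P s' \<and> Q n s s'" ..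
  qed
  then obtain f where f: "\<And>n. P (f n)" "\<And>n. Q n (f n) (f (Suc n))" by blast
  define A B where "A n = fst (f n)" and "B n = snd (f n)" for n
  have P: "A n \<subseteq> C" "B n \<subseteq> M - C" "\<not> separated ?S (A n) (B n)" for n
    using f(1)[of n] by (auto simp: P_def A_def B_def split: prod.splits)
  have Q: "\<exists>i. A (Suc n) = A n \<inter> T n i" "\<exists>i. B (Suc n) = B n \<inter> T n i" for n
    using f(2)[of n] by (auto simp: Q_def A_def B_def split: prod.splits)
  have dec: "decseq A" "decseq B" using Q by (auto simp: decseq_Suc_iff)
  have ne: "A n \<noteq> {} \<and> A n \<subseteq> M" "B n \<noteq> {} \<and> B n \<subseteq> M" for n
  proof -
    \<comment> \<open>An empty set is separated from anything inside \<open>M\<close> by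
      \<open>{}\<close> or by \<open>M\<close>, so inseparable sets are nonempty.\<close>
    have "separated ?S {} X" for X unfolding separated_def by (rule bexI[of _ "{}"]) auto
    moreover have "separated ?S X {}" if "X \<subseteq> M" for X
      unfolding separated_def using that by (intro bexI[of _ M]) auto
    ultimately show "A n \<noteq> {} \<and> A n \<subseteq> M" "B n \<noteq> {} \<and> B n \<subseteq> M"
      using P[of n] sub[OF C] by (metis subset_trans, metis Diff_subset subset_trans)
  qed
  have meets: "meets A S" "meets B S" if S: "S \<in> \<T>" for S
  proof -
    obtain n where "S = T n" using S range_T by (metis insertI2 imageE)
    then show "meets A S" "meets B S" unfolding meets_def using Q[of n] by (metis Int_lower2)+
  qed
  obtain c where c: "shrinks_to A c"
    using T0(3) dec(1) ne(1) meets(1) unfolding \<T>_def by (metis UnI1)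
  obtain e where e: "shrinks_to B e"
    using T0(3) dec(2) ne(2) meets(2) unfolding \<T>_def by (metis UnI1)
  have decA: "c \<in> G \<and> (\<exists>n. A n \<subseteq> G) \<or> c \<notin> G \<and> (\<exists>n. A n \<inter> G = {})"
    and decB: "e \<in> G \<and> (\<exists>n. B n \<subseteq> G) \<or> e \<notin> G \<and> (\<exists>n. B n \<inter> G = {})"
    if "G \<in> insert C \<G>" for G
  proof -
    have "\<forall>T\<in>\<T>1 G. meets A T" "\<forall>T\<in>\<T>1 G. meets B T" using meets that by (auto simp: \<T>_def)
    then show "c \<in> G \<and> (\<exists>n. A n \<subseteq> G) \<or> c \<notin> G \<and> (\<exists>n. A n \<inter> G = {})"
      and "e \<in> G \<and> (\<exists>n. B n \<subseteq> G) \<or> e \<notin> G \<and> (\<exists>n. B n \<inter> G = {})"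
      using T1[OF that] c e unfolding decided_by_def by blast+
  qed
  \<comment> \<open>Nonempty subsets of \<open>C\<close> cannot be disjoint from \<open>C\<close>,
    which leaves only the alternative that puts the limit in \<open>C\<close>; the dual argument
    applies to \<open>e\<close>.\<close>
  have "c \<in> C" using decA[of C] ne(1) P(1) by blast
  moreover have "e \<in> M - C" using decB[of C] ne(2) P(2) e unfolding shrinks_to_def by blast
  ultimately obtain G where G: "G \<in> \<G>" "\<not> (c \<in> G \<longleftrightarrow> e \<in> G)" using saturated by blast
  have GS: "G \<in> ?S" "M - G \<in> ?S" using G(1) by (auto intro: sigma_sets.intros)
  \<comment> \<open>The verdicts for \<open>A\<close> and \<open>B\<close> may come at different
    indices; the larger index serves both.\<close>
  have tail: "A (max k l) \<subseteq> A k" "B (max k l) \<subseteq> B l" for k l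
    using dec by (auto simp: decseq_def)
  show False
  proof (cases "c \<in> G")
    case True
    then obtain k l where "A k \<subseteq> G" "B l \<inter> G = {}" using decA[of G] decB[of G] G by blast
    then have "separated ?S (A (max k l)) (B (max k l))"
      unfolding separated_def using GS(1) tail[of k l] by blast
    then show False using P(3) by blast
  next
    case False
    then obtain k l where "A k \<inter> G = {}" "B l \<subseteq> G" using decA[of G] decB[of G] G by blast
    then have "separated ?S (A (max k l)) (B (max k l))"
      unfolding separated_def using GS(2) tail[of k l] ne(1)[of "max k l"]
      by (intro bexI[of _ "M - G"]) blast+
    then show False using P(3) by blast
  qed
qed

section \<open>Transfer from Polish to analytic spaces\<close>

lemma sigma_sets_vimage_continuous_map:
  assumes p: "continuous_map Y X p"
    and B: "B \<in> sigma_sets (topspace X) (Collect (openin X))"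
  shows "p -` B \<inter> topspace Y \<in> sigma_sets (topspace Y) (Collect (openin Y))"
  using B
proof induction
  case (Basic U)
  moreover have "p -` U \<inter> topspace Y = {x \<in> topspace Y. p x \<in> U}" by auto
  ultimately show ?case using p by (auto simp: continuous_map_def)
next
  case (Compl U)
  have "p -` (topspace X - U) \<inter> topspace Y = topspace Y - (p -` U \<inter> topspace Y)"
    using continuous_map_image_subset_topspace[OF p] by auto
  then show ?case using Compl sigma_sets.Compl by simp
next
  case (Union U)
  have "p -` (\<Union>i. U i) \<inter> topspace Y = (\<Union>i. p -` U i \<inter> topspace Y)" by auto
  moreover have "(\<Union>i. p -` U i \<inter> topspace Y) \<in> sigma_sets (topspace Y) (Collect (openin Y))"
    by (intro sigma_sets.Union Union)
  ultimately show ?case by simp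
qed (simp add: sigma_sets.Empty)

lemma analytic_space_polish_surjection:
  assumes "analytic_space X"
  obtains Y :: "real topology" and p where
    "polish_topology Y" "continuous_map Y X p" "p ` topspace Y = topspace X"
proof -
  obtain Y :: "real topology" and Z :: "real topology" and f where
    Y: "polish_topology Y" "continuous_map Y Z f" and
    h: "X homeomorphic_space subtopology Z (f ` topspace Y)"
    using assms unfolding analytic_space_def by blast
  obtain g where g: "homeomorphic_map (subtopology Z (f ` topspace Y)) X g"
    using h homeomorphic_space homeomorphic_space_sym by blast
  have top: "topspace (subtopology Z (f ` topspace Y)) = f ` topspace Y"
    using continuous_map_image_subset_topspace[OF Y(2)] by auto
  have "continuous_map Y (subtopology Z (f ` topspace Y)) f"
    using Y(2) by (simp add: continuous_map_in_subtopology)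
  then have "continuous_map Y X (g \<circ> f)"
    using homeomorphic_imp_continuous_map[OF g] continuous_map_compose by blast
  moreover have "(g \<circ> f) ` topspace Y = topspace X"
    using homeomorphic_imp_surjective_map[OF g] top by (simp add: image_comp)
  ultimately show ?thesis using that Y(1) by blast
qed

text \<open>Preimages under a continuous surjection \<open>p\<close> from a Polish space preserve
  being Borel and being saturated, so the metric version applies upstairs. Generation commutes with
  preimages, and surjectivity of \<open>p\<close> makes a set recoverable from its preimage.\<close>

theorem blackwell_analytic:
  assumes X: "analytic_space X"
    and \<G>: "countable \<G>" "\<G> \<subseteq> sigma_sets (topspace X) (Collect (openin X))"
    and C: "C \<in> sigma_sets (topspace X) (Collect (openin X))"
    and saturated: "\<And>x y. \<lbrakk>x \<in> C; y \<in> topspace X - C\<rbrakk> \<Longrightarrow> \<exists>G\<in>\<G>. \<not> (x \<in> G \<longleftrightarrow> y \<in> G)"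
  shows "C \<in> sigma_sets (topspace X) \<G>"
proof -
  obtain Y :: "real topology" and p where Y: "polish_topology Y" and
    p: "continuous_map Y X p" "p ` topspace Y = topspace X"
    using analytic_space_polish_surjection[OF X] .
  obtain N d where N: "Metric_space N d" "Metric_space.mcomplete N d" "Y = Metric_space.mtopology N d"
    using Y by (auto simp: polish_topology_def completely_metrizable_space_def)
  interpret Metric_space N d by fact
  have top: "topspace Y = N" by (simp add: N(3))
  let ?v = "\<lambda>B. p -` B \<inter> topspace Y"
  have "?v C \<in> sigma_sets N (?v ` \<G>)"
  proof (rule blackwell)
    show "separable_space mtopology" using Y N(3) by (simp add: polish_topology_def)
    show "?v ` \<G> \<subseteq> sigma_sets N (Collect (openin mtopology))"
      using sigma_sets_vimage_continuous_map[OF p(1)] \<G>(2) N(3) by auto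
    show "?v C \<in> sigma_sets N (Collect (openin mtopology))"
      using sigma_sets_vimage_continuous_map[OF p(1) C] N(3) by simp
    fix x y assume xy: "x \<in> ?v C" "y \<in> N - ?v C"
    then have "p x \<in> C" "p y \<in> topspace X - C" using p(2) top by auto
    then show "\<exists>G\<in>?v ` \<G>. \<not> (x \<in> G \<longleftrightarrow> y \<in> G)" using saturated xy top by fastforce
  qed (use N \<G> in auto)
  also have "?v ` \<G> = {?v B |B. B \<in> \<G>}" by blast
  also have "sigma_sets N {?v B |B. B \<in> \<G>} = {?v B |B. B \<in> sigma_sets (topspace X) \<G>}"
    using sigma_sets_vimage_commute[of p "topspace Y" "topspace X" \<G>] p(2) top by auto
  finally obtain D where D: "D \<in> sigma_sets (topspace X) \<G>" "?v C = ?v D" by blast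
  have sub: "B \<subseteq> topspace X" if "B \<in> sigma_sets (topspace X) (Collect (openin X))" for B
    using that by (rule sigma_sets_into_sp[rotated]) (use openin_subset in force)
  have "D \<subseteq> topspace X" using sigma_sets_into_sp[OF _ D(1)] \<G>(2) sub by auto
  moreover have "p ` ?v B = B" if "B \<subseteq> topspace X" for B
    using that unfolding p(2)[symmetric] by auto
  ultimately have "C = D" using D(2) sub[OF C] by metis
  then show ?thesis using D(1) by simp
qed

section \<open>Logical characterization of bisimulation\<close>

instance fm :: countable
  by countable_datatype

lemma continuous_markov_kernel_finite_measure:
  assumes "continuous_markov_kernel M \<theta>" "x \<in> space M"
  shows "finite_measure (\<theta> x)" "sets (\<theta> x) = sets M"
proof -
  have "\<theta> x \<in> space (finite_measure_space M)"
    using assms measurable_space unfolding continuous_markov_kernel_def by metis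
  moreover have "space (finite_measure_space M) = finite_measures M"
    unfolding finite_measure_space_def by (rule space_measure_of) auto
  ultimately show "finite_measure (\<theta> x)" "sets (\<theta> x) = sets M"
    by (auto simp: finite_measures_def)
qed

lemma continuous_markov_kernel_sets_ge:
  assumes cmk: "continuous_markov_kernel M \<theta>" and S: "S \<in> sets M"
  shows "{x \<in> space M. measure (\<theta> x) S \<ge> r} \<in> sets M"
\<comment> \<open>The \<sigma>-algebra on measures has generators for positive thresholds only; for
  the others the set is all of \<open>space M\<close>, measures being nonnegative.\<close>
proof (cases "r > 0")
  case True
  let ?A = "{\<mu> \<in> finite_measures M. measure \<mu> S \<ge> r}"
  have "?A \<in> sets (finite_measure_space M)"
    unfolding finite_measure_space_def using True S by (intro in_measure_of) auto
  moreover have "\<theta> \<in> measurable M (finite_measure_space M)"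
    using cmk by (simp add: continuous_markov_kernel_def)
  ultimately have "\<theta> -` ?A \<inter> space M \<in> sets M" using measurable_sets by blast
  moreover have "\<theta> -` ?A \<inter> space M = {x \<in> space M. measure (\<theta> x) S \<ge> r}"
    using continuous_markov_kernel_finite_measure[OF cmk] by (auto simp: finite_measures_def)
  ultimately show ?thesis by simp
next
  case False
  then have "{x \<in> space M. measure (\<theta> x) S \<ge> r} = space M"
    by (auto intro: order_trans[OF _ measure_nonneg])
  then show ?thesis by simp
qed

lemma sets_sat:
  assumes cmk: "continuous_markov_kernel M \<theta>"
  shows "{x \<in> space M. sat M \<theta> \<epsilon> x \<phi>} \<in> sets M"
proof (induction \<phi>)
  case (Neg \<phi>)
  have "{x \<in> space M. sat M \<theta> \<epsilon> x (Neg \<phi>)} = space M - {x \<in> space M. sat M \<theta> \<epsilon> x \<phi>}" by auto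
  then show ?case using Neg by simp
next
  case (And \<phi> \<psi>)
  have "{x \<in> space M. sat M \<theta> \<epsilon> x (And \<phi> \<psi>)} =
      {x \<in> space M. sat M \<theta> \<epsilon> x \<phi>} \<inter> {x \<in> space M. sat M \<theta> \<epsilon> x \<psi>}" by auto
  then show ?case using And by simp
next
  case (L r \<phi>)
  \<comment> \<open>The tolerance moves the threshold to \<open>r - \<epsilon>\<close>, which may
    have either sign.\<close>
  then show ?case
    using continuous_markov_kernel_sets_ge[OF cmk L, of "of_rat r - of_rat \<epsilon>"]
    by (simp add: diff_le_eq)
qed simp

text \<open>By induction, the set of states satisfying \<open>\<phi>\<close> is
  \<open>R\<close>-closed, so related states give it the same measure and agree on
  \<open>L r \<phi>\<close> whatever \<open>r\<close> and the tolerance are.\<close>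

lemma stochastic_bisimulation_sat:
  assumes cmk: "continuous_markov_kernel M \<theta>" and R: "stochastic_bisimulation M \<theta> R"
    and "(x, y) \<in> R"
  shows "sat M \<theta> \<epsilon> x \<phi> \<longleftrightarrow> sat M \<theta> \<epsilon> y \<phi>"
  using \<open>(x, y) \<in> R\<close>
proof (induction \<phi> arbitrary: x y)
  case (L r \<phi>)
  let ?C = "{x \<in> space M. sat M \<theta> \<epsilon> x \<phi>}"
  have "rel_closed R ?C"
    using L.IH R unfolding rel_closed_def stochastic_bisimulation_def by blast
  then have "measure (\<theta> x) ?C = measure (\<theta> y) ?C"
    using L.prems R sets_sat[OF cmk] unfolding stochastic_bisimulation_def by blast
  then show ?case by simp
qed auto

lemma positive_formulae_subset: "positive_formulae \<subseteq> formulae"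
proof
  fix \<phi> assume "\<phi> \<in> positive_formulae"
  then show "\<phi> \<in> formulae" by induction (auto intro: formulae.intros)
qed

section \<open>Positive logical equivalence is a bisimulation\<close>

text \<open>The \<pi>-\<lambda> argument. The measures are not normalised, so the complement step
  takes equality of total masses from \<open>space \<mu> \<in> \<G>\<close>.\<close>

lemma finite_measures_eq_on_sigma_sets:
  assumes \<mu>: "finite_measure \<mu>" and \<nu>: "finite_measure \<nu>" and sets: "sets \<mu> = sets \<nu>"
    and \<G>: "Int_stable \<G>" "\<G> \<subseteq> sets \<mu>" "space \<mu> \<in> \<G>"
    and eq: "\<And>G. G \<in> \<G> \<Longrightarrow> measure \<mu> G = measure \<nu> G"
    and C: "C \<in> sigma_sets (space \<mu>) \<G>"
  shows "measure \<mu> C = measure \<nu> C"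
proof -
  interpret \<mu>: finite_measure \<mu> by fact
  interpret \<nu>: finite_measure \<nu> by fact
  have space: "space \<nu> = space \<mu>" using sets_eq_imp_space_eq[OF sets] by simp
  have sub: "sigma_sets (space \<mu>) \<G> \<subseteq> sets \<mu>" using \<G>(2) by (rule sets.sigma_sets_subset)
  have "\<G> \<subseteq> Pow (space \<mu>)" using \<G>(2) sets.sets_into_space by blast
  from \<G>(1) this C show ?thesis
  proof (induction rule: sigma_sets_induct_disjoint)
    case (compl A)
    then have "A \<in> sets \<mu>" using sub by blast
    then show ?case
      using compl.IH \<mu>.finite_measure_compl[of A] \<nu>.finite_measure_compl[of A] sets space eq[OF \<G>(3)]
      by simp
  next
    case (union A)
    then have A: "range A \<subseteq> sets \<mu>" using sub by blast
    have "(\<lambda>i. measure \<mu> (A i)) sums measure \<mu> (\<Union>i. A i)"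
      using A union by (intro \<mu>.finite_measure_UNION)
    moreover have "(\<lambda>i. measure \<nu> (A i)) sums measure \<nu> (\<Union>i. A i)"
      using A union sets by (intro \<nu>.finite_measure_UNION) auto
    ultimately show ?case using union sums_unique2 by simp
  qed (simp_all add: eq)
qed

lemma positive_equivalence_measure_eq:
  assumes "\<epsilon> \<ge> 0" and \<phi>: "\<phi> \<in> positive_formulae"
    and eq: "\<And>\<psi>. \<psi> \<in> positive_formulae \<Longrightarrow> sat M \<theta> \<epsilon> x \<psi> \<longleftrightarrow> sat M \<theta> \<epsilon> y \<psi>"
  shows "measure (\<theta> x) {z \<in> space M. sat M \<theta> \<epsilon> z \<phi>} = measure (\<theta> y) {z \<in> space M. sat M \<theta> \<epsilon> z \<phi>}"
    (is "?a = ?b")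
proof -
  \<comment> \<open>The modality \<open>L (q + \<epsilon>)\<close> cancels the tolerance and tests
    the exact bound \<open>q\<close>; its index is nonnegative because \<open>\<epsilon>\<close>
    is.\<close>
  have iff: "of_rat q \<le> ?a \<longleftrightarrow> of_rat q \<le> ?b" if "q \<ge> 0" for q
    using eq[of "L (q + \<epsilon>) \<phi>"] that \<phi> \<open>\<epsilon> \<ge> 0\<close>
    by (simp add: positive_formulae.intros of_rat_add)
  \<comment> \<open>Only nonnegative rationals can be tested. This is enough, since a rational
    strictly above the nonnegative number \<open>b\<close> is positive.\<close>
  have le: "a \<le> b" if "0 \<le> b" "\<And>q. q \<ge> 0 \<Longrightarrow> of_rat q \<le> a \<Longrightarrow> of_rat q \<le> b" for a b :: real
  proof (rule ccontr)
    assume "\<not> a \<le> b"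
    then obtain q where q: "b < of_rat q" "of_rat q < a" using of_rat_dense[of b a] by auto
    then have "(0 :: real) < of_rat q" using that(1) by linarith
    then have "q \<ge> 0" by simp
    then show False using that(2)[of q] q by simp
  qed
  show ?thesis using le[of ?a ?b] le[of ?b ?a] iff by (simp add: order_antisym)
qed

lemma positive_equivalence_bisimulation:
  assumes cmk: "continuous_markov_kernel M \<theta>" and "\<epsilon> \<ge> 0"
  shows "stochastic_bisimulation M \<theta> {(x, y). x \<in> space M \<and> y \<in> space M \<and>
    (\<forall>\<phi>\<in>positive_formulae. sat M \<theta> \<epsilon> x \<phi> \<longleftrightarrow> sat M \<theta> \<epsilon> y \<phi>)}" (is "stochastic_bisimulation M \<theta> ?R")
proof -
  let ?I = "\<lambda>\<phi>. {x \<in> space M. sat M \<theta> \<epsilon> x \<phi>}"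
  define \<G> where "\<G> = ?I ` positive_formulae"
  obtain X where X: "analytic_space X" "space M = topspace X"
    "sets M = sigma_sets (topspace X) (Collect (openin X))"
    using cmk by (auto simp: continuous_markov_kernel_def)
  \<comment> \<open>Countability comes from the countability of the type \<open>fm\<close>, whose
    modalities carry rational indices.\<close>
  have \<G>: "countable \<G>" "\<G> \<subseteq> sets M" unfolding \<G>_def using sets_sat[OF cmk] by auto
  have stable: "Int_stable \<G>"
  proof (rule Int_stableI)
    fix A B assume "A \<in> \<G>" "B \<in> \<G>"
    then obtain \<phi> \<psi> where "\<phi> \<in> positive_formulae" "\<psi> \<in> positive_formulae" "A = ?I \<phi>" "B = ?I \<psi>"
      by (auto simp: \<G>_def)
    moreover from this have "A \<inter> B = ?I (And \<phi> \<psi>)" by auto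
    ultimately show "A \<inter> B \<in> \<G>" unfolding \<G>_def using positive_formulae.intros by blast
  qed
  \<comment> \<open>\<open>Top\<close> makes the total masses comparable.\<close>
  have "?I Top \<in> \<G>" unfolding \<G>_def using positive_formulae.intros by blast
  then have space: "space M \<in> \<G>" by simp
  have "measure (\<theta> x) C = measure (\<theta> y) C"
    if R: "(x, y) \<in> ?R" and C: "C \<in> sets M" "rel_closed ?R C" for x y C
  proof -
    \<comment> \<open>A point of the closed set \<open>C\<close> is unrelated to any point outside
      it, so some positive formula tells them apart: \<open>C\<close> is saturated for
      \<open>\<G>\<close>.\<close>
    have C_sigma: "C \<in> sigma_sets (space M) \<G>"
      unfolding X(2)
    proof (rule blackwell_analytic[OF X(1) \<G>(1)])
      fix x y assume xy: "x \<in> C" "y \<in> topspace X - C"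
      then have "(x, y) \<notin> ?R" using C(2) unfolding rel_closed_def by blast
      moreover have "x \<in> space M" "y \<in> space M" using xy X(2) sets.sets_into_space[OF C(1)] by auto
      ultimately show "\<exists>G\<in>\<G>. \<not> (x \<in> G \<longleftrightarrow> y \<in> G)" by (auto simp: \<G>_def)
    qed (use \<G> C X(3) in auto)
    have xy: "x \<in> space M" "y \<in> space M" using R by auto
    note x = continuous_markov_kernel_finite_measure[OF cmk xy(1)]
    note y = continuous_markov_kernel_finite_measure[OF cmk xy(2)]
    have space_x: "space (\<theta> x) = space M" using x(2) by (rule sets_eq_imp_space_eq)
    have eq: "measure (\<theta> x) G = measure (\<theta> y) G" if "G \<in> \<G>" for G
    proof -
      obtain \<phi> where "\<phi> \<in> positive_formulae" "G = ?I \<phi>" using \<open>G \<in> \<G>\<close> by (auto simp: \<G>_def)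
      then show ?thesis using positive_equivalence_measure_eq[OF \<open>\<epsilon> \<ge> 0\<close>, of \<phi> M \<theta> x y] R by simp
    qed
    show ?thesis
      by (rule finite_measures_eq_on_sigma_sets[OF x(1) y(1) _ stable _ _ eq])
        (simp_all add: x(2) y(2) space_x \<G>(2) space C_sigma)
  qed
  then show ?thesis unfolding stochastic_bisimulation_def by blast
qed

theorem theorem8:
  fixes M :: "'a measure" and \<theta> :: "'a \<Rightarrow> 'a measure" and \<epsilon> :: rat and m m' :: 'a
  assumes "continuous_markov_kernel M \<theta>"
    and "m \<in> space M" and "m' \<in> space M" and "\<epsilon> \<ge> 0"
  shows "(bisimilar M \<theta> m m' \<longleftrightarrow>
            (\<forall>\<phi> \<in> formulae. sat M \<theta> \<epsilon> m \<phi> \<longleftrightarrow> sat M \<theta> \<epsilon> m' \<phi>)) \<and>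
         (bisimilar M \<theta> m m' \<longleftrightarrow>
            (\<forall>\<phi> \<in> positive_formulae. sat M \<theta> \<epsilon> m \<phi> \<longleftrightarrow> sat M \<theta> \<epsilon> m' \<phi>))"
proof -
  have "sat M \<theta> \<epsilon> m \<phi> \<longleftrightarrow> sat M \<theta> \<epsilon> m' \<phi>" if "bisimilar M \<theta> m m'" for \<phi>
    using that stochastic_bisimulation_sat[OF assms(1)] unfolding bisimilar_def by blast
  moreover have "bisimilar M \<theta> m m'"
    if "\<forall>\<phi>\<in>positive_formulae. sat M \<theta> \<epsilon> m \<phi> \<longleftrightarrow> sat M \<theta> \<epsilon> m' \<phi>"
    unfolding bisimilar_def
    using positive_equivalence_bisimulation[OF assms(1,4)] that assms(2,3) by blast
  \<comment> \<open>The cycle closes: bisimilarity gives agreement on all formulae, hence on the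
    positive ones among them, and this gives bisimilarity back.\<close>
  ultimately show ?thesis using positive_formulae_subset by blast
qed

end
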